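(* Let $K$ be a field of any characteristic, let $\overline{K}$ be its algebraic closure, and let $a,b,c,d$ be arbitrary elements of $K$. Let \[ F=K\langle x,y\mid x^2+ax+b=0,\ y^2+cy+d=0\rangle . \] Then $F$ can be embedded, as a $K$-algebra, into the $2\times 2$ matrix algebra $M_2(\overline{K}[t])$ over the polynomial algebra $\overline{K}[t]$ in one variable. Moreover, $F$ and $M_2(\overline{K})$ satisfy the same polynomial identities as $K$-algebras, i.e. $T_K(F)=T_K(M_2(\overline{K}))$.
   Context: All algebras are associative and unital, and homomorphisms and embeddings are of unital algebras. $K\langle x,y\mid x^2+ax+b=0,\ y^2+cy+d=0\rangle$ denotes the quotient of the free unital associative $K$-algebra on $x,y$ by the two-sided ideal generated by $x^2+ax+b$ and $y^2+cy+d$. For a $K$-algebra $S$, a polynomial $f(x_1,\ldots,x_n)$ in the free unital associative algebra $K\langle x_1,x_2,\ldots\rangle$ on countably many generators is a polynomial identity of $S$ (as a $K$-algebra) if $f(s_1,\ldots,s_n)=0$ for all $s_1,\ldots,s_n\in S$. $T_K(S)\subseteq K\langle x_1,x_2,\ldots\rangle$ denotes the set (T-ideal) of all polynomial identities of $S$ as a $K$-algebra. *)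

theory Defs
  imports
    "HOL-Library.Poly_Mapping"
    "HOL-Algebra.QuotRing"
    "HOL-Algebra.Algebraic_Closure_Type"
    "Jordan_Normal_Form.Matrix"
begin

section \<open>Free algebras\<close>

text \<open>Lists form the free monoid under concatenation, written additively so that the convolution
  product of \<^theory>\<open>HOL-Library.Poly_Mapping\<close> makes \<^typ>\<open>'x list \<Rightarrow>\<^sub>0 'k\<close> its monoid
  algebra, i.e.\ the free unital associative algebra on \<^typ>\<open>'x\<close>.\<close>

instantiation list :: (type) monoid_add
begin

definition zero_list :: "'a list" where "zero_list = []"
definition plus_list :: "'a list \<Rightarrow> 'a list \<Rightarrow> 'a list" where "plus_list = (@)"

instance by standard (simp_all add: zero_list_def plus_list_def)

end

text \<open>A \<open>'k\<close>-algebra is given by a \<^type>\<open>module\<close> record, which carries both a ring structure and a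
  scalar multiplication. The library locale \<^locale>\<open>algebra\<close> is not used, as it requires the ring
  to be commutative.\<close>

definition free_alg :: "('k::field, 'x list \<Rightarrow>\<^sub>0 'k) module" where
  "free_alg = \<lparr>carrier = UNIV, monoid.mult = (*), one = 1, ring.zero = 0, add = (+),
     module.smult = (\<lambda>k f. Poly_Mapping.map ((*) k) f)\<rparr>"

definition gen :: "'x \<Rightarrow> ('x list \<Rightarrow>\<^sub>0 'k::field)" where
  "gen x = Poly_Mapping.single [x] 1"

definition const :: "'k \<Rightarrow> ('x list \<Rightarrow>\<^sub>0 'k::field)" where
  "const k = Poly_Mapping.single [] k"

section \<open>Quotient algebras and algebras given by generators and relations\<close>

text \<open>For a two-sided ideal \<open>I\<close> the union below is the single coset \<open>I +> k \<odot> f\<close>, for any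
  representative \<open>f\<close> of \<open>C\<close> (compare \<^const>\<open>rcoset_mult\<close>).\<close>

definition quot_alg :: "('k, 'a) module \<Rightarrow> 'a set \<Rightarrow> ('k, 'a set) module" where
  "quot_alg A I = ring.extend (A Quot I)
     (module.fields (\<lambda>k C. \<Union>f\<in>C. I +>\<^bsub>A\<^esub> (k \<odot>\<^bsub>A\<^esub> f)))"

datatype gens = Gx | Gy

definition quad_alg :: "'k::field \<Rightarrow> 'k \<Rightarrow> 'k \<Rightarrow> 'k \<Rightarrow> ('k, (gens list \<Rightarrow>\<^sub>0 'k) set) module" where
  "quad_alg a b c d = quot_alg free_alg (Idl\<^bsub>free_alg\<^esub>
     {gen Gx ^ 2 + const a * gen Gx + const b, gen Gy ^ 2 + const c * gen Gy + const d})"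

section \<open>Matrix algebras\<close>

text \<open>The algebra of \<open>n \<times> n\<close> matrices over a commutative \<open>'k\<close>-algebra with structure map
  \<open>\<iota> :: 'k \<Rightarrow> 'r\<close>.\<close>

definition mat_alg :: "nat \<Rightarrow> ('k \<Rightarrow> 'r::comm_ring_1) \<Rightarrow> ('k, 'r mat) module" where
  "mat_alg n \<iota> = ring_mat TYPE('r) n (module.fields (\<lambda>k M. \<iota> k \<cdot>\<^sub>m M))"

section \<open>Embeddings and polynomial identities\<close>

definition alg_embedding :: "('k, 'a) module \<Rightarrow> ('k, 'b) module \<Rightarrow> ('a \<Rightarrow> 'b) \<Rightarrow> bool" where
  "alg_embedding A B \<phi> \<longleftrightarrow> \<phi> \<in> Ring.ring_hom A B \<and>
     (\<forall>k. \<forall>u\<in>carrier A. \<phi> (k \<odot>\<^bsub>A\<^esub> u) = k \<odot>\<^bsub>B\<^esub> \<phi> u) \<and> inj_on \<phi> (carrier A)"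

definition alg_eval :: "('k::field, 'a) module \<Rightarrow> ('x \<Rightarrow> 'a) \<Rightarrow> ('x list \<Rightarrow>\<^sub>0 'k) \<Rightarrow> 'a" where
  "alg_eval S s f = (\<Oplus>\<^bsub>S\<^esub>w\<in>Poly_Mapping.keys f. Poly_Mapping.lookup f w \<odot>\<^bsub>S\<^esub>
     foldr (\<otimes>\<^bsub>S\<^esub>) (map s w) \<one>\<^bsub>S\<^esub>)"

definition T_ideal :: "('k::field, 'a) module \<Rightarrow> (nat list \<Rightarrow>\<^sub>0 'k) set" where
  "T_ideal S = {f. \<forall>s. (\<forall>i. s i \<in> carrier S) \<longrightarrow> alg_eval S s f = \<zero>\<^bsub>S\<^esub>}"

end

theory Submission
  imports Defs
begin

text \<open>
  Write \<open>\<Lambda>\<close> for the algebraic closure of \<open>K\<close>. The element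
  \<open>z = xy + (y + c)(x + a)\<close> is central in \<open>F\<close>. In a matrix representation in which \<open>x\<close> and \<open>y\<close>
  have trace \<open>- a\<close> and \<open>- c\<close>, the factors \<open>x + a\<close> and \<open>y + c\<close> are minus the adjugates of \<open>x\<close> and
  \<open>y\<close>, so \<open>z\<close> becomes the scalar \<open>tr (xy)\<close>. Using \<open>z\<close> to rewrite \<open>yx\<close>, every element of \<open>F\<close> takes
  the form \<open>p\<^sub>0(z) + p\<^sub>1(z) x + p\<^sub>2(z) y + p\<^sub>3(z) xy\<close> with polynomials \<open>p\<^sub>i\<close> over \<open>K\<close>
  (\<open>normal_form_exists\<close>).

  Let \<open>r, r'\<close> and \<open>s, s'\<close> be the roots in \<open>\<Lambda>\<close> of the two quadratic polynomials. An upper triangular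
  \<open>U\<close> with diagonal \<open>r, r'\<close> and a lower triangular \<open>V\<close> with diagonal \<open>s, s'\<close> satisfy the relations
  whatever their remaining entries are; these are chosen so that \<open>z\<close> goes to the scalar \<open>t\<close>. Then
  \<open>1, U, V, UV\<close> are linearly independent over \<open>\<Lambda>[t]\<close> (\<open>comb_eq_0\<close>), so the normal form of an
  element in the kernel has all \<open>p\<^sub>i = 0\<close>, and \<open>F\<close> embeds into \<open>M\<^sub>2(\<Lambda>[t])\<close> (\<open>in_I_iff\<close>).

  An identity of \<open>M\<^sub>2(\<Lambda>)\<close> holds in \<open>M\<^sub>2(\<Lambda>[t])\<close>, hence in \<open>F\<close>, because a polynomial over the infinite
  field \<open>\<Lambda>\<close> that vanishes at every specialization of \<open>t\<close> is zero.

  Conversely, an identity \<open>f\<close> of \<open>F\<close> vanishes at all matrices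
  \<open>q\<^sub>0 + q\<^sub>1 U + q\<^sub>2 V + q\<^sub>3 UV\<close> with \<open>q\<^sub>j\<close> in \<open>K[t]\<close>. Even if \<open>K\<close> is finite, \<open>K[t]\<close> is an infinite
  subset of the domain \<open>\<Lambda>[t]\<close>, and the value of \<open>f\<close> depends polynomially on every single
  coefficient \<open>q\<^sub>j\<close>; replacing the coefficients one at a time, \<open>f\<close> still vanishes when they range
  over \<open>\<Lambda>[t]\<close> (\<open>identity_extends\<close>). For all but two values \<open>l\<close> of \<open>t\<close> the specialized matrices
  \<open>1, U, V, UV\<close> span \<open>M\<^sub>2(\<Lambda>)\<close> (\<open>comb_surj\<close>), so \<open>f\<close> is an identity of \<open>M\<^sub>2(\<Lambda>)\<close>.
\<close>

section \<open>Two by two matrices as a ring type\<close>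

text \<open>Matrices of a fixed size do not form a type, so the type class laws of rings and the
  simplifier setup based on them do not apply to \<^typ>\<open>'a mat\<close>. The computations take place in this
  copy of the two by two matrices; \<open>to_mat\<close> below carries the results over.\<close>

datatype 'a m2 = M2 (m11: 'a) (m12: 'a) (m21: 'a) (m22: 'a)

instantiation m2 :: (comm_ring_1) ring_1
begin

definition "0 = M2 0 0 0 0"
definition "1 = M2 1 0 0 1"
definition "A + B = M2 (m11 A + m11 B) (m12 A + m12 B) (m21 A + m21 B) (m22 A + m22 B)"
definition "A - B = M2 (m11 A - m11 B) (m12 A - m12 B) (m21 A - m21 B) (m22 A - m22 B)"
definition "- A = M2 (- m11 A) (- m12 A) (- m21 A) (- m22 A)"
definition "A * B = M2 (m11 A * m11 B + m12 A * m21 B) (m11 A * m12 B + m12 A * m22 B)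
  (m21 A * m11 B + m22 A * m21 B) (m21 A * m12 B + m22 A * m22 B)"

instance
  by standard
    (auto simp: zero_m2_def one_m2_def plus_m2_def minus_m2_def uminus_m2_def times_m2_def
      algebra_simps m2.expand)

end

lemmas m2_defs = zero_m2_def one_m2_def plus_m2_def minus_m2_def uminus_m2_def times_m2_def

lemma m2_eq_0_iff: "A = 0 \<longleftrightarrow> m11 A = 0 \<and> m12 A = 0 \<and> m21 A = 0 \<and> m22 A = 0"
  for A :: "'a::comm_ring_1 m2"
  by (cases A) (simp add: m2_defs)

definition sc :: "'a::comm_ring_1 \<Rightarrow> 'a m2" where "sc r = M2 r 0 0 r"

definition to_mat :: "'a::comm_ring_1 m2 \<Rightarrow> 'a mat" where
  "to_mat A = mat 2 2 (\<lambda>(i, j). if i = 0 then (if j = 0 then m11 A else m12 A)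
     else (if j = 0 then m21 A else m22 A))"

lemma to_mat_carrier [simp]: "to_mat A \<in> carrier_mat 2 2"
  by (simp add: to_mat_def)

lemma inj_to_mat: "inj to_mat"
proof (rule injI)
  fix A B :: "'a m2" assume eq: "to_mat A = to_mat B"
  have "to_mat A $$ (i, j) = to_mat B $$ (i, j)" for i j using eq by simp
  from this[of 0 0] this[of 0 1] this[of 1 0] this[of 1 1] show "A = B"
    by (simp add: to_mat_def m2.expand)
qed

lemma range_to_mat: "range to_mat = carrier_mat 2 2"
proof (intro equalityI subsetI)
  fix M :: "'a mat" assume M: "M \<in> carrier_mat 2 2"
  have "M = to_mat (M2 (M $$ (0,0)) (M $$ (0,1)) (M $$ (1,0)) (M $$ (1,1)))"
    using M by (intro eq_matI) (auto simp: to_mat_def less_2_cases_iff)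
  then show "M \<in> range to_mat" by blast
qed auto

lemma to_mat_add: "to_mat (A + B) = to_mat A + to_mat B"
  by (rule eq_matI) (auto simp: to_mat_def less_2_cases_iff m2_defs)

lemma to_mat_mult: "to_mat (A * B) = to_mat A * to_mat B"
  by (rule eq_matI)
    (auto simp: to_mat_def less_2_cases_iff m2_defs scalar_prod_def numeral_2_eq_2)

lemma to_mat_1: "to_mat 1 = 1\<^sub>m 2"
  by (rule eq_matI) (auto simp: to_mat_def less_2_cases_iff m2_defs)

lemma to_mat_0: "to_mat 0 = 0\<^sub>m 2 2"
  by (rule eq_matI) (auto simp: to_mat_def less_2_cases_iff m2_defs)

lemma to_mat_sc: "to_mat (sc r * A) = r \<cdot>\<^sub>m to_mat A"
  by (rule eq_matI) (auto simp: to_mat_def less_2_cases_iff m2_defs sc_def)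

lemma sc_simps [simp]: "sc 0 = 0" "sc 1 = 1" "sc (r + r') = sc r + sc r'"
    "sc (r * r') = sc r * sc r'"
  by (simp_all add: sc_def m2_defs)

lemma sc_central: "sc r * A = A * sc r"
  by (simp add: sc_def m2_defs mult.commute)

section \<open>Evaluating noncommutative polynomials in a ring\<close>

lemma poly_mapping_as_sum:
  "f = (\<Sum>w\<in>Poly_Mapping.keys f. Poly_Mapping.single w (Poly_Mapping.lookup f w))"
  by (rule poly_mapping_eqI)
    (auto simp: lookup_sum lookup_single when_def in_keys_iff sum.delta)

text \<open>The evaluation homomorphism for values in a ring of a type class. The structure map
  \<open>\<iota>\<close> plays the part of the scalar multiplication, so its values have to commute with
  everything for \<open>ev\<close> to be multiplicative.\<close>

definition ev :: "('k::field \<Rightarrow> 'r::ring_1) \<Rightarrow> ('x \<Rightarrow> 'r) \<Rightarrow> ('x list \<Rightarrow>\<^sub>0 'k) \<Rightarrow> 'r" where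
  "ev \<iota> s f =
    (\<Sum>w\<in>Poly_Mapping.keys f. \<iota> (Poly_Mapping.lookup f w) * prod_list (map s w))"

lemma ev_cong:
  assumes "\<And>w x. w \<in> Poly_Mapping.keys f \<Longrightarrow> x \<in> set w \<Longrightarrow> s x = s' x"
  shows "ev \<iota> s f = ev \<iota> s' f"
proof -
  have "map s w = map s' w" if "w \<in> Poly_Mapping.keys f" for w
    using assms that by simp
  then show ?thesis unfolding ev_def by (intro sum.cong refl) (simp only:)
qed

locale central_hom =
  fixes \<iota> :: "'k::field \<Rightarrow> 'r::ring_1"
  assumes hom_0: "\<iota> 0 = 0" and hom_1: "\<iota> 1 = 1"
    and hom_add: "\<iota> (k + l) = \<iota> k + \<iota> l" and hom_mult: "\<iota> (k * l) = \<iota> k * \<iota> l"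
    and central: "\<iota> k * u = u * \<iota> k"
begin

lemma ev_superset:
  assumes "finite W" "Poly_Mapping.keys f \<subseteq> W"
  shows "ev \<iota> s f = (\<Sum>w\<in>W. \<iota> (Poly_Mapping.lookup f w) * prod_list (map s w))"
  unfolding ev_def using assms by (intro sum.mono_neutral_left) (auto simp: in_keys_iff hom_0)

lemma ev_add: "ev \<iota> s (f + g) = ev \<iota> s f + ev \<iota> s g"
proof -
  let ?W = "Poly_Mapping.keys f \<union> Poly_Mapping.keys g"
  have "finite ?W" "Poly_Mapping.keys (f + g) \<subseteq> ?W" by (simp_all add: Poly_Mapping.keys_add)
  then show ?thesis
    by (subst (1 2 3) ev_superset[of ?W])
      (auto simp: lookup_add hom_add algebra_simps sum.distrib)
qed

lemma ev_single: "ev \<iota> s (Poly_Mapping.single w k) = \<iota> k * prod_list (map s w)"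
  by (subst ev_superset[of "{w}"]) (auto simp: lookup_single)

lemma ev_0 [simp]: "ev \<iota> s 0 = 0" by (simp add: ev_def)

lemma ev_sum: "ev \<iota> s (sum h W) = (\<Sum>w\<in>W. ev \<iota> s (h w))"
  by (induction W rule: infinite_finite_induct) (auto simp: ev_add)

lemma ev_minus: "ev \<iota> s (f - g) = ev \<iota> s f - ev \<iota> s g"
  using ev_add[of s "f - g" g] by simp

lemma ev_mult:
  fixes s :: "'x \<Rightarrow> 'r"
  shows "ev \<iota> s (f * g) = ev \<iota> s f * ev \<iota> s g"
proof -
  have swap: "u * (\<iota> k * v) = \<iota> k * (u * v)" for u v k
  proof -
    have "u * (\<iota> k * v) = (u * \<iota> k) * v" by (simp only: mult.assoc)
    also have "\<dots> = (\<iota> k * u) * v" by (simp only: central[of k u])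
    finally show ?thesis by (simp only: mult.assoc)
  qed
  have single: "ev \<iota> s (Poly_Mapping.single w k * Poly_Mapping.single v l) =
      ev \<iota> s (Poly_Mapping.single w k) * ev \<iota> s (Poly_Mapping.single v l)" for w v k l
    by (simp add: mult_single ev_single plus_list_def hom_mult mult.assoc swap[of "prod_list _"])
  have "ev \<iota> s (sum h W * sum h' W') = ev \<iota> s (sum h W) * ev \<iota> s (sum h' W')"
    if "\<And>w v. ev \<iota> s (h w * h' v) = ev \<iota> s (h w) * ev \<iota> s (h' v)"
    for h h' :: "'x list \<Rightarrow> ('x list \<Rightarrow>\<^sub>0 'k)" and W W'
    by (simp add: sum_product ev_sum that)
  from this[of "\<lambda>w. Poly_Mapping.single w (Poly_Mapping.lookup f w)"
      "\<lambda>w. Poly_Mapping.single w (Poly_Mapping.lookup g w)"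
      "Poly_Mapping.keys f" "Poly_Mapping.keys g", OF single]
  show ?thesis
    by (simp only: poly_mapping_as_sum[symmetric])
qed

lemma ev_const [simp]: "ev \<iota> s (const k) = \<iota> k"
  by (simp add: const_def ev_single)

lemma ev_gen [simp]: "ev \<iota> s (gen x) = s x"
  by (simp add: gen_def ev_single hom_1)

lemma ev_1 [simp]: "ev \<iota> s 1 = 1"
  using ev_const[of s 1] by (simp only: const_def hom_1 flip: single_one zero_list_def)

end

lemma central_hom_sc:
  assumes "h 0 = 0" "h 1 = 1" "\<And>k l. h (k + l) = h k + h l" "\<And>k l. h (k * l) = h k * h l"
  shows "central_hom (\<lambda>k. sc (h k))"
  by standard (simp_all only: assms sc_simps, rule sc_central)

lemma ev_ring_hom:
  fixes s :: "'x \<Rightarrow> 'r::ring_1" and f :: "'x list \<Rightarrow>\<^sub>0 'k::field" and h :: "'r \<Rightarrow> 'q::ring_1"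
  assumes "h 0 = 0" "h 1 = 1" "\<And>u v. h (u + v) = h u + h v" "\<And>u v. h (u * v) = h u * h v"
  shows "h (ev \<iota> s f) = ev (\<lambda>k. h (\<iota> k)) (\<lambda>x. h (s x)) f"
proof -
  have prod: "h (prod_list (map s w)) = prod_list (map (\<lambda>x. h (s x)) w)" for w
    by (induction w) (simp_all add: assms)
  have sum: "h (sum g A) = (\<Sum>x\<in>A. h (g x))" for g :: "'x list \<Rightarrow> 'r" and A
    by (induction A rule: infinite_finite_induct) (simp_all add: assms(1,3))
  show ?thesis by (simp only: ev_def sum assms(4) prod)
qed

section \<open>Identities of matrix algebras and of their subalgebras\<close>

lemma alg_eval_mat:
  fixes \<iota> :: "'k::field \<Rightarrow> 'r::comm_ring_1" and s :: "'x \<Rightarrow> 'r m2"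
  shows "alg_eval (mat_alg 2 \<iota>) (\<lambda>i. to_mat (s i)) f = to_mat (ev (\<lambda>k. sc (\<iota> k)) s f)"
proof -
  let ?M = "mat_alg 2 \<iota>"
  interpret M: ring ?M unfolding mat_alg_def by (rule ring_mat)
  have M [simp]: "carrier ?M = carrier_mat 2 2" "add ?M = (+)" "zero ?M = 0\<^sub>m 2 2"
    "monoid.mult ?M = (*)" "one ?M = 1\<^sub>m 2" "k \<odot>\<^bsub>?M\<^esub> A = \<iota> k \<cdot>\<^sub>m A" for k A
    by (simp_all add: mat_alg_def ring_mat_def module.defs)
  have prod: "foldr (*) (map (\<lambda>i. to_mat (s i)) w) (1\<^sub>m 2) = to_mat (prod_list (map s w))" for w
    by (induction w) (simp_all add: to_mat_1 to_mat_mult)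
  have "finsum ?M (\<lambda>w. to_mat (g w)) W = to_mat (sum g W)" if "finite W"
    for W and g :: "'x list \<Rightarrow> 'r m2"
    using that by induction (simp_all add: to_mat_0 to_mat_add)
  then show ?thesis
    by (simp add: alg_eval_def ev_def prod flip: to_mat_sc)
qed

lemma T_ideal_mat:
  fixes \<iota> :: "'k::field \<Rightarrow> 'r::comm_ring_1"
  shows "T_ideal (mat_alg 2 \<iota>) = {f. \<forall>s. ev (\<lambda>k. sc (\<iota> k)) s f = 0}"
proof -
  have M: "carrier (mat_alg 2 \<iota>) = range to_mat" "\<zero>\<^bsub>mat_alg 2 \<iota>\<^esub> = to_mat 0"
    by (simp_all add: mat_alg_def ring_mat_simps range_to_mat to_mat_0)
  have "(\<forall>S. (\<forall>i. S i \<in> range to_mat) \<longrightarrow> alg_eval (mat_alg 2 \<iota>) S f = to_mat 0) \<longleftrightarrow>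
      (\<forall>s. ev (\<lambda>k. sc (\<iota> k)) s f = 0)" (is "?L \<longleftrightarrow> ?R") for f :: "nat list \<Rightarrow>\<^sub>0 'k"
  proof
    assume ?L
    then have "to_mat (ev (\<lambda>k. sc (\<iota> k)) s f) = to_mat 0" for s
      by (simp flip: alg_eval_mat)
    then show ?R by (simp add: inj_eq[OF inj_to_mat])
  next
    assume R: ?R
    show ?L
    proof (intro allI impI)
      fix S :: "nat \<Rightarrow> 'r mat" assume "\<forall>i. S i \<in> range to_mat"
      then have "\<forall>i. \<exists>A. S i = to_mat A" by auto
      from choice[OF this] obtain s where "S = (\<lambda>i. to_mat (s i))" by auto
      with R show "alg_eval (mat_alg 2 \<iota>) S f = to_mat 0" by (simp add: alg_eval_mat)
    qed
  qed
  then show ?thesis by (simp add: T_ideal_def M)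
qed

lemma alg_eval_hom:
  fixes A :: "('k::field, 'a) module" and B :: "('k, 'b) module"
  assumes "ring A" "ring B" and smult: "\<And>k u. u \<in> carrier A \<Longrightarrow> k \<odot>\<^bsub>A\<^esub> u \<in> carrier A"
    and \<phi>: "\<phi> \<in> Ring.ring_hom A B"
      "\<And>k u. u \<in> carrier A \<Longrightarrow> \<phi> (k \<odot>\<^bsub>A\<^esub> u) = k \<odot>\<^bsub>B\<^esub> \<phi> u"
    and s: "\<And>i. s i \<in> carrier A"
  shows "\<phi> (alg_eval A s f) = alg_eval B (\<lambda>i. \<phi> (s i)) f" "alg_eval A s f \<in> carrier A"
proof -
  interpret A: ring A by fact
  interpret B: ring B by fact
  interpret h: ring_hom_ring A B \<phi> by (rule ring_hom_ringI2) fact+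
  let ?p = "\<lambda>w. foldr (\<otimes>\<^bsub>A\<^esub>) (map s w) \<one>\<^bsub>A\<^esub>"
  have p: "?p w \<in> carrier A" for w by (induction w) (auto simp: s)
  have hp: "\<phi> (?p w) = foldr (\<otimes>\<^bsub>B\<^esub>) (map (\<lambda>i. \<phi> (s i)) w) \<one>\<^bsub>B\<^esub>" for w
    by (induction w) (auto simp: s p)
  show "\<phi> (alg_eval A s f) = alg_eval B (\<lambda>i. \<phi> (s i)) f"
    by (simp add: alg_eval_def p smult \<phi>(2) hp[symmetric] Pi_def o_def)
  show "alg_eval A s f \<in> carrier A"
    by (simp add: alg_eval_def p smult Pi_def)
qed

text \<open>An embedding reflects zero, so the identities of \<open>A\<close> can be tested inside \<open>B\<close>, on the
  image of \<open>A\<close> only.\<close>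

lemma T_ideal_embedded:
  fixes A :: "('k::field, 'a) module" and B :: "('k, 'b) module"
  assumes "ring A" "ring B" "\<And>k u. u \<in> carrier A \<Longrightarrow> k \<odot>\<^bsub>A\<^esub> u \<in> carrier A"
    and "alg_embedding A B \<phi>"
  shows "T_ideal A = {f. \<forall>s. (\<forall>i. s i \<in> \<phi> ` carrier A) \<longrightarrow> alg_eval B s f = \<zero>\<^bsub>B\<^esub>}"
proof -
  interpret A: ring A by fact
  interpret B: ring B by fact
  have \<phi>: "\<phi> \<in> Ring.ring_hom A B" "inj_on \<phi> (carrier A)"
      "\<And>k u. u \<in> carrier A \<Longrightarrow> \<phi> (k \<odot>\<^bsub>A\<^esub> u) = k \<odot>\<^bsub>B\<^esub> \<phi> u"
    using assms(4) by (auto simp: alg_embedding_def)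
  interpret h: ring_hom_ring A B \<phi> by (rule ring_hom_ringI2) fact+
  note hom = alg_eval_hom[OF assms(1-3) \<phi>(1,3)]
  have "alg_eval A s f = \<zero>\<^bsub>A\<^esub> \<longleftrightarrow> alg_eval B (\<lambda>i. \<phi> (s i)) f = \<zero>\<^bsub>B\<^esub>"
    if "\<forall>i. s i \<in> carrier A" for s and f :: "nat list \<Rightarrow>\<^sub>0 'k"
    using hom[of s f] that \<phi>(2) by (metis A.zero_closed h.hom_zero inj_onD)
  moreover have "(\<forall>S. (\<forall>i. S i \<in> \<phi> ` carrier A) \<longrightarrow> Q S) \<longleftrightarrow>
      (\<forall>s. (\<forall>i. s i \<in> carrier A) \<longrightarrow> Q (\<lambda>i. \<phi> (s i)))" for Q :: "(nat \<Rightarrow> 'b) \<Rightarrow> bool"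
  proof (intro iffI allI impI)
    fix S :: "nat \<Rightarrow> 'b" assume Q: "\<forall>s. (\<forall>i. s i \<in> carrier A) \<longrightarrow> Q (\<lambda>i. \<phi> (s i))"
      and "\<forall>i. S i \<in> \<phi> ` carrier A"
    then have "\<forall>i. \<exists>u. u \<in> carrier A \<and> S i = \<phi> u" by auto
    from choice[OF this] obtain s where "\<forall>i. s i \<in> carrier A \<and> S i = \<phi> (s i)" ..
    moreover from this have "S = (\<lambda>i. \<phi> (s i))" by auto
    ultimately show "Q S" using Q by simp
  qed auto
  ultimately show ?thesis by (simp add: T_ideal_def)
qed

section \<open>Quotients of the free algebra\<close>

lemma free_alg_simps [simp]:
  "carrier free_alg = UNIV" "monoid.mult free_alg = (*)" "one free_alg = 1" "ring.zero free_alg = 0"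
  "add free_alg = (+)"
  by (simp_all add: free_alg_def)

lemma free_alg_smult [simp]: "k \<odot>\<^bsub>free_alg\<^esub> f = const k * f"
  by (simp add: free_alg_def mult_map_scale_conv_mult const_def zero_list_def)

lemma ring_free_alg: "ring free_alg"
proof (rule ringI)
  show "abelian_group free_alg"
    by (rule abelian_groupI) (auto simp: algebra_simps intro: exI[of _ "- _"])
qed (unfold_locales; auto simp: algebra_simps)+

lemma const_central:
  fixes f :: "'x list \<Rightarrow>\<^sub>0 'k::field"
  shows "const k * f = f * const k"
proof -
  have "const k * sum g W = sum g W * const k"
    if "\<And>w. const k * g w = g w * const k" for g :: "'x list \<Rightarrow> ('x list \<Rightarrow>\<^sub>0 'k)" and W
    by (simp add: sum_distrib_left sum_distrib_right that)
  from this[of "\<lambda>w. Poly_Mapping.single w (Poly_Mapping.lookup f w)" "Poly_Mapping.keys f"]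
  show ?thesis
    by (simp add: const_def mult_single plus_list_def mult.commute flip: poly_mapping_as_sum)
qed

lemma const_left_commute: "f * (const k * g) = const k * (f * g)"
proof -
  have "f * (const k * g) = (f * const k) * g" by (simp only: mult.assoc)
  also have "\<dots> = (const k * f) * g" by (simp only: const_central[of k f])
  finally show ?thesis by (simp only: mult.assoc)
qed

lemma const_simps: "const (k + l) = const k + const l" "const (k * l) = const k * const l"
    "const (- k) = - const k" "const 0 = 0"
  by (simp_all add: const_def single_add mult_single plus_list_def single_uminus)

lemma const_1 [simp]: "const 1 = 1"
  by (simp only: const_def flip: single_one zero_list_def)

locale free_ideal = I: ideal I "free_alg" for I :: "('x list \<Rightarrow>\<^sub>0 'k::field) set"
begin

abbreviation coset :: "('x list \<Rightarrow>\<^sub>0 'k) \<Rightarrow> ('x list \<Rightarrow>\<^sub>0 'k) set" where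
  "coset f \<equiv> I +>\<^bsub>free_alg\<^esub> f"

abbreviation Q :: "('k, ('x list \<Rightarrow>\<^sub>0 'k) set) module" where
  "Q \<equiv> quot_alg free_alg I"

lemma closed: "0 \<in> I" "f \<in> I \<Longrightarrow> g \<in> I \<Longrightarrow> f + g \<in> I" "f \<in> I \<Longrightarrow> g * f \<in> I"
    "f \<in> I \<Longrightarrow> f * g \<in> I" "f \<in> I \<Longrightarrow> - f \<in> I" "f \<in> I \<Longrightarrow> g \<in> I \<Longrightarrow> f - g \<in> I"
proof -
  show *: "0 \<in> I" "f \<in> I \<Longrightarrow> g \<in> I \<Longrightarrow> f + g \<in> I" "f \<in> I \<Longrightarrow> g * f \<in> I"
    "f \<in> I \<Longrightarrow> f * g \<in> I" for f g
    using additive_subgroup.zero_closed[OF I.additive_subgroup_axioms]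
      additive_subgroup.a_closed[OF I.additive_subgroup_axioms, of f g]
      I.I_l_closed[of f g] I.I_r_closed[of f g] by auto
  show "f \<in> I \<Longrightarrow> - f \<in> I" for f using *(3)[of f "- 1"] by simp
  from this[of g] *(2)[of f "- g"] show "f \<in> I \<Longrightarrow> g \<in> I \<Longrightarrow> f - g \<in> I" by simp
qed

lemma mem_coset: "g \<in> coset f \<longleftrightarrow> g - f \<in> I"
  by (force simp: a_r_coset_def' intro: bexI[of _ "_ - _"])

lemma coset_eq_iff: "coset f = coset g \<longleftrightarrow> f - g \<in> I"
proof
  assume "coset f = coset g"
  moreover have "f \<in> coset f" by (simp add: mem_coset closed)
  ultimately show "f - g \<in> I" by (simp add: mem_coset)
next
  assume fg: "f - g \<in> I"
  have "h - f \<in> I \<longleftrightarrow> h - g \<in> I" for h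
    using closed(2)[of "h - f" "f - g"] closed(6)[of "h - g" "f - g"] fg by auto
  then show "coset f = coset g" by (auto simp: mem_coset)
qed

lemma quot_alg_simps:
  "carrier Q = range coset"
  "\<zero>\<^bsub>Q\<^esub> = coset 0"
  "\<one>\<^bsub>Q\<^esub> = coset 1"
  "coset f \<oplus>\<^bsub>Q\<^esub> coset g = coset (f + g)"
  "coset f \<otimes>\<^bsub>Q\<^esub> coset g = coset (f * g)"
  "k \<odot>\<^bsub>Q\<^esub> coset f = coset (const k * f)"
proof -
  note defs = quot_alg_def ring.defs module.defs FactRing_simps
  show "carrier Q = range coset"
    by (auto simp: quot_alg_def ring.defs FactRing_def A_RCOSETS_def')
  show "\<zero>\<^bsub>Q\<^esub> = coset 0" "\<one>\<^bsub>Q\<^esub> = coset 1"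
    by (auto simp: defs mem_coset)
  show "coset f \<oplus>\<^bsub>Q\<^esub> coset g = coset (f + g)"
    using I.a_rcos_sum[of f g] by (simp add: defs)
  show "coset f \<otimes>\<^bsub>Q\<^esub> coset g = coset (f * g)"
    using I.rcoset_mult_add[of f g] by (simp add: defs)
  have "coset (const k * g) = coset (const k * f)"
    if "g \<in> coset f" for g
    using closed(3)[of "g - f" "const k"] that by (simp add: coset_eq_iff mem_coset algebra_simps)
  moreover have "f \<in> coset f" by (simp add: mem_coset closed)
  ultimately have "(\<Union>g\<in>coset f. coset (const k * g)) = coset (const k * f)"
    by blast
  then show "k \<odot>\<^bsub>Q\<^esub> coset f = coset (const k * f)"
    by (simp add: defs)
qed

lemma ring_quot_alg: "ring Q"
proof (rule ringI)
  show "abelian_group Q"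
  proof (rule abelian_groupI)
    fix C assume "C \<in> carrier Q"
    then obtain f where "C = coset f" by (auto simp: quot_alg_simps)
    then have "coset (- f) \<oplus>\<^bsub>Q\<^esub> C = \<zero>\<^bsub>Q\<^esub>"
      by (simp add: quot_alg_simps)
    then show "\<exists>D\<in>carrier Q. D \<oplus>\<^bsub>Q\<^esub> C = \<zero>\<^bsub>Q\<^esub>"
      by (auto simp: quot_alg_simps(1))
  qed (auto simp: quot_alg_simps algebra_simps)
  show "Group.monoid Q"
    by (rule monoidI) (auto simp: quot_alg_simps mult.assoc)
qed (auto simp: quot_alg_simps algebra_simps)

end

text \<open>The homomorphism theorem for matrix representations. As the evaluation is constant on every
  coset, the induced map takes the one element of the image of the coset.\<close>

lemma quot_alg_embedding:
  fixes \<iota> :: "'k::field \<Rightarrow> 'r::comm_ring_1"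
  assumes "free_ideal I" and hom: "central_hom (\<lambda>k. sc (\<iota> k))"
    and ker: "\<And>f. f \<in> I \<longleftrightarrow> ev (\<lambda>k. sc (\<iota> k)) s f = 0"
  defines "\<phi> \<equiv> (\<lambda>C. to_mat (the_elem (ev (\<lambda>k. sc (\<iota> k)) s ` C)))"
  shows "alg_embedding (quot_alg free_alg I) (mat_alg 2 \<iota>) \<phi>"
    and "\<phi> ` carrier (quot_alg free_alg I) = to_mat ` range (ev (\<lambda>k. sc (\<iota> k)) s)"
proof -
  interpret free_ideal I by fact
  interpret hom: central_hom "\<lambda>k. sc (\<iota> k)" by fact
  let ?e = "ev (\<lambda>k. sc (\<iota> k)) s"
  have "?e ` coset f = {?e f}" for f
  proof -
    have "?e g = ?e f" if "g \<in> coset f" for g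
      using that by (simp add: mem_coset ker hom.ev_minus)
    then have "?e ` coset f = (\<lambda>_. ?e f) ` coset f" by (rule image_cong[OF refl])
    moreover have "f \<in> coset f" by (simp add: mem_coset closed)
    ultimately show ?thesis by auto
  qed
  then have \<phi>: "\<phi> (coset f) = to_mat (?e f)" for f by (simp add: \<phi>_def)
  have M: "carrier (mat_alg 2 \<iota>) = carrier_mat 2 2" "add (mat_alg 2 \<iota>) = (+)"
    "monoid.mult (mat_alg 2 \<iota>) = (*)" "one (mat_alg 2 \<iota>) = 1\<^sub>m 2" "k \<odot>\<^bsub>mat_alg 2 \<iota>\<^esub> A = \<iota> k \<cdot>\<^sub>m A" for k A
    by (simp_all add: mat_alg_def ring_mat_def module.defs)
  show "alg_embedding Q (mat_alg 2 \<iota>) \<phi>"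
    unfolding alg_embedding_def
  proof (intro conjI allI ballI)
    show "\<phi> \<in> Ring.ring_hom Q (mat_alg 2 \<iota>)"
      by (rule ring_hom_memI)
        (auto simp: quot_alg_simps \<phi> M hom.ev_add hom.ev_mult to_mat_add to_mat_mult to_mat_1)
    show "\<phi> (k \<odot>\<^bsub>Q\<^esub> u) = k \<odot>\<^bsub>mat_alg 2 \<iota>\<^esub> \<phi> u"
      if "u \<in> carrier Q" for k u
      using that by (auto simp: quot_alg_simps \<phi> M hom.ev_mult to_mat_sc)
    show "inj_on \<phi> (carrier Q)"
    proof (rule inj_onI)
      fix C D assume "C \<in> carrier Q" "D \<in> carrier Q" and eq: "\<phi> C = \<phi> D"
      then obtain f g where "C = coset f" "D = coset g" by (auto simp: quot_alg_simps)
      with eq show "C = D"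
        by (simp add: \<phi> coset_eq_iff ker hom.ev_minus inj_eq[OF inj_to_mat])
    qed
  qed
  show "\<phi> ` carrier Q = to_mat ` range ?e"
    by (simp add: quot_alg_simps image_image \<phi>)
qed

section \<open>The normal form\<close>

locale quad =
  fixes a b c d :: "'k::field"
begin

abbreviation x :: "gens list \<Rightarrow>\<^sub>0 'k" where "x \<equiv> gen Gx"
abbreviation y :: "gens list \<Rightarrow>\<^sub>0 'k" where "y \<equiv> gen Gy"

definition rel_x :: "gens list \<Rightarrow>\<^sub>0 'k" where "rel_x = x ^ 2 + const a * x + const b"
definition rel_y :: "gens list \<Rightarrow>\<^sub>0 'k" where "rel_y = y ^ 2 + const c * y + const d"

definition I :: "(gens list \<Rightarrow>\<^sub>0 'k) set" where "I = Idl\<^bsub>free_alg\<^esub> {rel_x, rel_y}"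

sublocale free_ideal I
  unfolding I_def by (rule free_ideal.intro, rule ring.genideal_ideal[OF ring_free_alg]) simp

lemma rel_in_I: "rel_x \<in> I" "rel_y \<in> I"
  using ring.genideal_self[OF ring_free_alg, of "{rel_x, rel_y}"] by (auto simp: I_def)

text \<open>Modulo the relations, \<open>z\<close> commutes with \<open>x\<close> and \<open>y\<close>: expanding gives
  \<open>x z - z x = rel_x y - y rel_x\<close>, and similarly for \<open>y\<close>.\<close>

definition z :: "gens list \<Rightarrow>\<^sub>0 'k" where "z = x * y + (y + const c) * (x + const a)"

text \<open>The value of a polynomial at \<open>z\<close> by Horner's rule; \<^const>\<open>poly\<close> only evaluates in commutative
  rings.\<close>

definition at_z :: "'k poly \<Rightarrow> (gens list \<Rightarrow>\<^sub>0 'k)" where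
  "at_z p = fold_coeffs (\<lambda>k f. const k + f * z) p 0"

lemma at_z_0 [simp]: "at_z 0 = 0"
  by (simp add: at_z_def)

lemma at_z_pCons [simp]: "at_z (pCons k p) = const k + at_z p * z"
proof (cases "k = 0 \<and> p = 0")
  case False
  then show ?thesis by (auto simp: at_z_def fold_coeffs_pCons_eq)
qed (simp add: const_simps)

lemma at_z_add: "at_z (p + q) = at_z p + at_z q"
  by (induction p q rule: poly_induct2) (simp_all add: const_simps algebra_simps)

lemma at_z_smult: "at_z (smult k p) = const k * at_z p"
  by (induction p) (simp_all add: algebra_simps flip: const_simps(2))

lemma at_z_minus: "at_z (- p) = - at_z p"
  using at_z_smult[of "- 1" p] by (simp add: const_simps(3))

lemma at_z_diff: "at_z (p - q) = at_z p - at_z q"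
  using at_z_add[of p "- q"] by (simp add: at_z_minus)

definition nf :: "'k poly \<Rightarrow> 'k poly \<Rightarrow> 'k poly \<Rightarrow> 'k poly \<Rightarrow> (gens list \<Rightarrow>\<^sub>0 'k)" where
  "nf p0 p1 p2 p3 = at_z p0 + at_z p1 * x + at_z p2 * y + at_z p3 * x * y"

lemma nf_add:
  "nf (p0 + q0) (p1 + q1) (p2 + q2) (p3 + q3) = nf p0 p1 p2 p3 + nf q0 q1 q2 q3"
  by (simp add: nf_def at_z_add algebra_simps)

lemma nf_smult: "nf (smult k p0) (smult k p1) (smult k p2) (smult k p3) = const k * nf p0 p1 p2 p3"
  by (simp add: nf_def at_z_smult algebra_simps)

text \<open>Rewrite rules that collect all scalars in one constant on the left. Each is oriented for
  specific factors, since general commutation with constants would loop.\<close>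

lemma const_move:
  "gen g * const k = const k * (gen g :: gens list \<Rightarrow>\<^sub>0 'k)"
  "gen g * (const k * f) = const k * (gen g * (f :: gens list \<Rightarrow>\<^sub>0 'k))"
  "at_z p * const k = const k * at_z p"
  "at_z p * (const k * f) = const k * (at_z p * f)"
  "const k * const l = (const (k * l) :: gens list \<Rightarrow>\<^sub>0 'k)"
  "const k * (const l * f) = const (k * l) * (f :: gens list \<Rightarrow>\<^sub>0 'k)"
  using const_left_commute[of "gen g" k f] const_left_commute[of "at_z p" k f]
  by (simp_all only: const_central[of k "gen g"] const_central[of k "at_z p"] const_simps(2) mult.assoc)

text \<open>These two identities hold in the free algebra itself, with an explicit error term in the ideal
  on the right. For \<open>x\<close> they come from \<open>x\<^sup>2 \<equiv> - a x - b\<close>, from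
  \<open>y x = z - x y - a y - c x - c a\<close>, which is the definition of \<open>z\<close>, and from their consequence
  \<open>x y x \<equiv> z x + b y + b c\<close>.\<close>

lemma nf_mult_x:
  "nf p0 p1 p2 p3 * x =
     nf (pCons 0 p2 - smult b p1 - smult (c * a) p2 + smult (b * c) p3)
        (p0 - smult a p1 - smult c p2 + pCons 0 p3) (smult b p3 - smult a p2) (- p2)
     + (at_z p1 - at_z p3 * (y + const c)) * rel_x"
  by (simp add: nf_def at_z_add at_z_smult at_z_diff at_z_minus z_def rel_x_def power2_eq_square
      const_simps(3,4) algebra_simps const_move)

lemma nf_mult_y:
  "nf p0 p1 p2 p3 * y =
     nf (- smult d p2) (- smult d p3) (p0 - smult c p2) (p1 - smult c p3)
     + (at_z p2 + at_z p3 * x) * rel_y"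
  by (simp add: nf_def at_z_add at_z_smult at_z_diff at_z_minus rel_y_def power2_eq_square
      const_simps(3,4) algebra_simps const_move)

text \<open>The elements with a normal form are closed under linear combinations and under multiplication
  by \<open>x\<close> and \<open>y\<close> from the right, and they contain 1, so they contain every word.\<close>

lemma normal_form_exists: "\<exists>p0 p1 p2 p3. f - nf p0 p1 p2 p3 \<in> I"
proof -
  define S where "S = {f. \<exists>p0 p1 p2 p3. f - nf p0 p1 p2 p3 \<in> I}"
  have add: "f + g \<in> S" if "f \<in> S" "g \<in> S" for f g
  proof -
    from that obtain p0 p1 p2 p3 q0 q1 q2 q3
      where "f - nf p0 p1 p2 p3 \<in> I" "g - nf q0 q1 q2 q3 \<in> I" by (auto simp: S_def)
    from closed(2)[OF this] have "f + g - nf (p0 + q0) (p1 + q1) (p2 + q2) (p3 + q3) \<in> I"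
      by (simp add: nf_add algebra_simps)
    then show ?thesis unfolding S_def by blast
  qed
  have scale: "const k * f \<in> S" if "f \<in> S" for k f
  proof -
    from that obtain p0 p1 p2 p3 where "f - nf p0 p1 p2 p3 \<in> I" by (auto simp: S_def)
    from closed(3)[OF this, of "const k"]
    have "const k * f - nf (smult k p0) (smult k p1) (smult k p2) (smult k p3) \<in> I"
      by (simp add: nf_smult algebra_simps)
    then show ?thesis unfolding S_def by blast
  qed
  have gen: "f * gen g \<in> S" if "f \<in> S" for f g
  proof -
    from that obtain p0 p1 p2 p3 where f: "f - nf p0 p1 p2 p3 \<in> I" by (auto simp: S_def)
    obtain q0 q1 q2 q3 h where h: "nf p0 p1 p2 p3 * gen g = nf q0 q1 q2 q3 + h" "h \<in> I"
      by (cases g) (metis nf_mult_x nf_mult_y closed(3) rel_in_I)+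
    have "(f - nf p0 p1 p2 p3) * gen g + h \<in> I" by (intro closed f h)
    then have "f * gen g - nf q0 q1 q2 q3 \<in> I" by (simp add: left_diff_distrib h(1))
    then show ?thesis unfolding S_def by blast
  qed
  have one: "1 \<in> S"
  proof -
    have "1 - nf [:1:] 0 0 0 \<in> I" by (simp add: nf_def closed)
    then show ?thesis unfolding S_def by blast
  qed
  have word: "Poly_Mapping.single w 1 \<in> S" for w
  proof (induction w rule: rev_induct)
    case Nil
    then show ?case using one by (simp add: zero_list_def flip: single_one)
  next
    case (snoc g w)
    then show ?case using gen[of "Poly_Mapping.single w 1" g]
      by (simp add: gen_def mult_single plus_list_def)
  qed
  have "Poly_Mapping.single w k \<in> S" for w k
    using scale[OF word[of w], of k] by (simp add: const_def mult_single plus_list_def)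
  moreover have zero: "0 \<in> S" using scale[OF one, of 0] by (simp add: const_simps)
  ultimately have "sum (\<lambda>w. Poly_Mapping.single w (h w)) W \<in> S" for h W
    by (induction W rule: infinite_finite_induct) (auto intro: add)
  from this[of "Poly_Mapping.lookup f" "Poly_Mapping.keys f"] have "f \<in> S"
    by (simp only: poly_mapping_as_sum[symmetric])
  then show ?thesis by (simp add: S_def)
qed

end

section \<open>Two triangular matrices and their product\<close>

definition comb :: "'r::comm_ring_1 m2 \<Rightarrow> 'r m2 \<Rightarrow> (nat \<Rightarrow> 'r) \<Rightarrow> 'r m2" where
  "comb U V q = sc (q 0) + sc (q 1) * U + sc (q 2) * V + sc (q 3) * U * V"

text \<open>The entries (1,2) and (2,1) express \<open>q\<^sub>1\<close> and \<open>q\<^sub>2\<close> through \<open>q\<^sub>3\<close>, the entry (2,2) does so for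
  \<open>q\<^sub>0\<close>, and the entry (1,1) then reads \<open>q\<^sub>3 ((r - r')(t - t') + w) = 0\<close>. Up to sign,
  \<open>w ((r - r')(t - t') + w)\<close> is the determinant of this four by four linear system.\<close>

lemma comb_eq_0:
  fixes r r' t t' w :: "'r::idom"
  assumes "comb (M2 r 1 0 r') (M2 t 0 w t') q = 0"
    and w: "w \<noteq> 0" and D: "(r - r') * (t - t') + w \<noteq> 0"
  shows "q 0 = 0 \<and> q 1 = 0 \<and> q 2 = 0 \<and> q 3 = 0"
proof -
  have e: "q 0 + q 1 * r + q 2 * t + q 3 * (r * t + w) = 0" "q 1 + q 3 * t' = 0"
    "w * (q 2 + q 3 * r') = 0" "q 0 + q 1 * r' + q 2 * t' + q 3 * (r' * t') = 0"
    using assms(1) by (simp_all add: comb_def sc_def m2_defs algebra_simps)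
  from e(3) w have "q 2 + q 3 * r' = 0" by simp
  with e(2) have q12: "q 1 = - (q 3 * t')" "q 2 = - (q 3 * r')"
    by (simp_all only: eq_neg_iff_add_eq_0)
  with e(4) have q0: "q 0 = q 3 * (r' * t')" by (simp add: algebra_simps)
  have "q 3 * ((r - r') * (t - t') + w) = 0"
    using e(1) unfolding q0 q12 by (simp add: algebra_simps)
  with D have "q 3 = 0" by simp
  with q0 q12 show ?thesis by simp
qed

text \<open>Over a field the same linear system can be solved by the same elimination.\<close>

lemma comb_surj:
  fixes r r' t t' w :: "'r::field"
  assumes w: "w \<noteq> 0" and D: "(r - r') * (t - t') + w \<noteq> 0"
  shows "\<exists>q. comb (M2 r 1 0 r') (M2 t 0 w t') q = A"
proof -
  \<comment> \<open>The values that the entries (1,2) and (2,1) force on \<open>q\<^sub>1 + q\<^sub>3 t'\<close> and \<open>q\<^sub>2 + q\<^sub>3 r'\<close>.\<close>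
  define u v where "u = m12 A" and "v = m21 A / w"
  define q3 where "q3 = (m11 A - m22 A - (r - r') * u - (t - t') * v) / ((r - r') * (t - t') + w)"
  define q where "q = (\<lambda>j::nat. if j = 0 then m22 A - r' * u - t' * v + q3 * (r' * t')
    else if j = 1 then u - q3 * t' else if j = 2 then v - q3 * r' else q3)"
  have q: "q 0 = m22 A - r' * u - t' * v + q3 * (r' * t')" "q (Suc 0) = u - q3 * t'"
    "q 2 = v - q3 * r'" "q 3 = q3"
    by (simp_all add: q_def)
  have q3: "q3 * ((r - r') * (t - t') + w) = m11 A - m22 A - (r - r') * u - (t - t') * v"
    using D by (simp add: q3_def)
  have "w * v = m21 A" using w by (simp add: v_def)
  then have m21: "w * (q 2 + q 3 * r') = m21 A" by (simp add: q)
  have "q 0 + q 1 * r + q 2 * t + q 3 * (r * t + w) =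
      m22 A + (r - r') * u + (t - t') * v + q3 * ((r - r') * (t - t') + w)"
    by (simp add: q algebra_simps)
  then have m11: "q 0 + q 1 * r + q 2 * t + q 3 * (r * t + w) = m11 A"
    by (simp add: q3)
  have m12: "q 1 + q 3 * t' = m12 A" by (simp add: q u_def)
  have m22: "q 0 + q 1 * r' + q 2 * t' + q 3 * (r' * t') = m22 A"
    by (simp add: q algebra_simps)
  have "comb (M2 r 1 0 r') (M2 t 0 w t') q = A"
    by (rule m2.expand) (use m11 m12 m21 m22 in \<open>simp add: comb_def sc_def m2_defs algebra_simps\<close>)
  then show ?thesis by blast
qed

section \<open>Identities survive enlarging the coefficients\<close>

lemma poly_0_if_infinitely_many_roots:
  fixes p :: "'a::idom poly"
  assumes "infinite P" "\<And>t. t \<in> P \<Longrightarrow> poly p t = 0"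
  shows "p = 0"
  using assms by (metis (mono_tags) mem_Collect_eq poly_roots_finite rev_finite_subset subsetI)

text \<open>Over a finite field, one plus the product of all linear factors \<open>T - a\<close> takes the value 1
  everywhere, so it would be a nonconstant polynomial without a root.\<close>

lemma alg_closed_infinite: "infinite (UNIV :: 'a::alg_closed_field set)"
proof
  assume fin: "finite (UNIV :: 'a set)"
  define p where "p = (\<Prod>a\<in>UNIV. [:- a, 1:]) + (1 :: 'a poly)"
  have p1: "poly p t = 1" for t
    using fin by (auto simp: p_def poly_prod prod_zero_iff)
  show False
  proof (cases "degree p > 0")
    case True
    then obtain t where "poly p t = 0" using alg_closed_imp_poly_has_root by blast
    with p1 show False by simp
  next
    case False
    then obtain e where "p = [:e:]" by (auto elim: degree_eq_zeroE)
    with p1[of 0] have "p = 1" by simp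
    then show False using fin by (simp add: p_def)
  qed
qed

definition polynomial_map :: "('r::comm_ring_1 \<Rightarrow> 'r m2) \<Rightarrow> bool" where
  "polynomial_map h \<longleftrightarrow> (\<exists>P :: 'r poly m2. \<forall>t.
     h t = M2 (poly (m11 P) t) (poly (m12 P) t) (poly (m21 P) t) (poly (m22 P) t))"

lemma polynomial_map_const: "polynomial_map (\<lambda>_. A)"
  unfolding polynomial_map_def
  by (rule exI[of _ "M2 [:m11 A:] [:m12 A:] [:m21 A:] [:m22 A:]"]) simp

lemma polynomial_map_sc: "polynomial_map sc"
  unfolding polynomial_map_def
  by (rule exI[of _ "M2 [:0, 1:] 0 0 [:0, 1:]"]) (simp add: sc_def)

lemma polynomial_map_add:
  "polynomial_map h \<Longrightarrow> polynomial_map g \<Longrightarrow> polynomial_map (\<lambda>t. h t + g t)"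
  unfolding polynomial_map_def
proof (elim exE)
  fix P Q :: "'a poly m2"
  assume "\<forall>t. h t = M2 (poly (m11 P) t) (poly (m12 P) t) (poly (m21 P) t) (poly (m22 P) t)"
    and "\<forall>t. g t = M2 (poly (m11 Q) t) (poly (m12 Q) t) (poly (m21 Q) t) (poly (m22 Q) t)"
  then show "\<exists>P. \<forall>t. h t + g t =
      M2 (poly (m11 P) t) (poly (m12 P) t) (poly (m21 P) t) (poly (m22 P) t)"
    by (intro exI[of _ "P + Q"]) (simp add: plus_m2_def)
qed

lemma polynomial_map_mult:
  "polynomial_map h \<Longrightarrow> polynomial_map g \<Longrightarrow> polynomial_map (\<lambda>t. h t * g t)"
  unfolding polynomial_map_def
proof (elim exE)
  fix P Q :: "'a poly m2"
  assume "\<forall>t. h t = M2 (poly (m11 P) t) (poly (m12 P) t) (poly (m21 P) t) (poly (m22 P) t)"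
    and "\<forall>t. g t = M2 (poly (m11 Q) t) (poly (m12 Q) t) (poly (m21 Q) t) (poly (m22 Q) t)"
  then show "\<exists>P. \<forall>t. h t * g t =
      M2 (poly (m11 P) t) (poly (m12 P) t) (poly (m21 P) t) (poly (m22 P) t)"
    by (intro exI[of _ "P * Q"]) (simp add: times_m2_def)
qed

lemma polynomial_map_ev:
  assumes "\<And>i. polynomial_map (\<lambda>t. s t i)"
  shows "polynomial_map (\<lambda>t. ev \<iota> (s t) f)"
proof -
  have word: "polynomial_map (\<lambda>t. prod_list (map (s t) w))" for w
    by (induction w) (auto intro: polynomial_map_const polynomial_map_mult assms)
  have "polynomial_map (\<lambda>t. \<Sum>w\<in>W. \<iota> (Poly_Mapping.lookup f w) * prod_list (map (s t) w))" for W
  proof (induction W rule: infinite_finite_induct)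
    case (insert w W)
    show ?case
      using polynomial_map_add[OF polynomial_map_mult[OF polynomial_map_const word] insert.IH]
        insert.hyps by simp
  qed (simp_all add: polynomial_map_const)
  then show ?thesis by (simp add: ev_def)
qed

lemma polynomial_map_eq_0:
  fixes h :: "'r::idom \<Rightarrow> 'r m2"
  assumes "polynomial_map h" "infinite P" "\<And>t. t \<in> P \<Longrightarrow> h t = 0"
  shows "h t = 0"
proof -
  from assms(1) obtain Q :: "'r poly m2" where
    h: "\<And>t. h t = M2 (poly (m11 Q) t) (poly (m12 Q) t) (poly (m21 Q) t) (poly (m22 Q) t)"
    unfolding polynomial_map_def by blast
  have "m11 Q = 0" "m12 Q = 0" "m21 Q = 0" "m22 Q = 0"
    by (rule poly_0_if_infinitely_many_roots[OF assms(2)]; use assms(3) h in \<open>simp add: m2_eq_0_iff\<close>)+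
  then show ?thesis by (simp add: h zero_m2_def)
qed

text \<open>With all coefficients but one fixed, the value is polynomial in that coefficient, and a
  polynomial over a domain that vanishes on an infinite set is zero. Replacing one coefficient at a
  time, polynomials in one variable suffice.\<close>

lemma identity_extends:
  fixes U V :: "'r::idom m2" and f :: "'x list \<Rightarrow>\<^sub>0 'k::field" and q :: "'x \<Rightarrow> nat \<Rightarrow> 'r"
  assumes P: "infinite P"
    and id: "\<And>q. (\<And>i j. q i j \<in> P) \<Longrightarrow> ev \<iota> (\<lambda>i. comb U V (q i)) f = 0"
  shows "ev \<iota> (\<lambda>i. comb U V (q i)) f = 0"
proof -
  \<comment> \<open>A slot \<open>(i, j)\<close> is the \<open>j\<close>-th coefficient of the matrix put in for the variable \<open>i\<close>; the
    slots in \<open>S\<close> are already free, those outside still hold elements of \<open>P\<close>.\<close>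
  have slots: "ev \<iota> (\<lambda>i. comb U V (q i)) f = 0"
    if "finite S" "\<And>i j. (i, j) \<notin> S \<Longrightarrow> q i j \<in> P" for S q
    using that
  proof (induction S arbitrary: q rule: finite_induct)
    case empty
    then show ?case by (intro id) auto
  next
    case (insert ij S)
    obtain i j where ij: "ij = (i, j)" by fastforce
    define q' where "q' t = q(i := (q i)(j := t))" for t
    have "polynomial_map (\<lambda>t. comb U V (q' t i'))" for i'
    proof -
      have "polynomial_map (\<lambda>t. sc (q' t i' j'))" for j'
      proof -
        have "(\<lambda>t. sc (q' t i' j')) = (if i' = i \<and> j' = j then sc else (\<lambda>_. sc (q i' j')))"
          by (auto simp: q'_def fun_eq_iff)
        then show ?thesis by (simp add: polynomial_map_const polynomial_map_sc)
      qed
      then show ?thesis unfolding comb_def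
        by (intro polynomial_map_add polynomial_map_mult polynomial_map_const)
    qed
    then have "polynomial_map (\<lambda>t. ev \<iota> (\<lambda>i'. comb U V (q' t i')) f)"
      by (rule polynomial_map_ev)
    moreover have "ev \<iota> (\<lambda>i'. comb U V (q' t i')) f = 0" if "t \<in> P" for t
      using that insert.prems by (intro insert.IH) (auto simp: q'_def ij)
    ultimately have "ev \<iota> (\<lambda>i'. comb U V (q' (q i j) i')) f = 0"
      by (rule polynomial_map_eq_0[OF _ P])
    then show ?case by (simp add: q'_def)
  qed
  \<comment> \<open>Slots of variables outside \<open>f\<close>, or with \<open>j \<ge> 4\<close>, do not influence the value and may be filled
    with an element of \<open>P\<close>; finitely many remain.\<close>
  define W where "W = (\<Union>w\<in>Poly_Mapping.keys f. set w)"
  obtain e where e: "e \<in> P" using P by (metis equals0I finite.emptyI)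
  define q' where "q' i j = (if i \<in> W \<and> j < 4 then q i j else e)" for i j
  have "comb U V (q i) = comb U V (q' i)" if "i \<in> W" for i
    using that by (simp add: q'_def comb_def)
  then have "ev \<iota> (\<lambda>i. comb U V (q i)) f = ev \<iota> (\<lambda>i. comb U V (q' i)) f"
    by (intro ev_cong) (auto simp: W_def)
  also have "\<dots> = 0"
    by (rule slots[of "W \<times> {..<4}"]) (auto simp: W_def q'_def e)
  finally show ?thesis .
qed

definition specialize :: "'r::comm_ring_1 \<Rightarrow> 'r poly m2 \<Rightarrow> 'r m2" where
  "specialize l A = M2 (poly (m11 A) l) (poly (m12 A) l) (poly (m21 A) l) (poly (m22 A) l)"

lemma specialize_ev:
  "specialize l (ev \<iota> s f) = ev (\<lambda>k. specialize l (\<iota> k)) (\<lambda>i. specialize l (s i)) f"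
  by (rule ev_ring_hom) (simp_all add: specialize_def m2_defs)

lemma specialize_eq_0:
  fixes A :: "'r::idom poly m2"
  assumes "infinite (UNIV :: 'r set)" "\<And>l. specialize l A = 0"
  shows "A = 0"
proof -
  have "m11 A = 0" "m12 A = 0" "m21 A = 0" "m22 A = 0"
    by (rule poly_0_if_infinitely_many_roots[OF assms(1)];
        use assms(2) in \<open>simp add: m2_eq_0_iff specialize_def\<close>)+
  then show ?thesis by (simp add: m2_eq_0_iff)
qed

lemma specialize_comb:
  "specialize l (comb U V q) = comb (specialize l U) (specialize l V) (\<lambda>j. poly (q j) l)"
  by (simp add: comb_def specialize_def m2_defs sc_def)

section \<open>The faithful representation over the polynomial ring\<close>

lemma quadratic_splits:
  fixes a b :: "'k::alg_closed_field"
  obtains r r' where "r + r' = - a" "r * r' = b"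
proof -
  obtain r where "poly [:b, a, 1:] r = 0"
    using alg_closed_imp_poly_has_root[of "[:b, a, 1:]"] by auto
  then have "b - r * (- a - r) = 0" by (simp add: algebra_simps)
  then show ?thesis using that[of r "- a - r"] by simp
qed

definition inc :: "'k::field \<Rightarrow> 'k alg_closure poly" where "inc k = [:to_ac k:]"

lemma central_hom_inc: "central_hom (\<lambda>k. sc (inc k))"
  by (rule central_hom_sc) (simp_all add: inc_def)

text \<open>The sum and the product of the roots are prescribed, rather than the roots themselves, so that
  the case of a double root is included.\<close>

locale quad_roots = quad a b c d for a b c d :: "'k::field" +
  fixes r r' s s' :: "'k alg_closure"
  assumes roots: "r + r' = - to_ac a" "r * r' = to_ac b"
    "s + s' = - to_ac c" "s * s' = to_ac d"
begin

definition U :: "'k alg_closure poly m2" where "U = M2 [:r:] 1 0 [:r':]"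

text \<open>The corner entry is \<open>t - (r s + r' s')\<close>, which makes the trace of \<open>U V\<close> equal to \<open>t\<close>.\<close>

definition V :: "'k alg_closure poly m2" where
  "V = M2 [:s:] 0 [:- (r * s + r' * s'), 1:] [:s':]"

definition rep :: "(gens list \<Rightarrow>\<^sub>0 'k) \<Rightarrow> 'k alg_closure poly m2" where
  "rep = ev (\<lambda>k. sc (inc k)) (case_gens U V)"

sublocale R: central_hom "\<lambda>k. sc (inc k)"
  by (rule central_hom_inc)

lemma rep_simps: "rep (f + g) = rep f + rep g" "rep (f * g) = rep f * rep g"
    "rep 1 = 1" "rep 0 = 0" "rep (const k) = sc (inc k)" "rep x = U" "rep y = V"
    "rep (f - g) = rep f - rep g"
  by (simp_all add: rep_def R.ev_add R.ev_mult R.ev_minus)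

lemma coeffs: "to_ac a = - (r + r')" "to_ac b = r * r'" "to_ac c = - (s + s')" "to_ac d = s * s'"
  using roots by (simp_all add: equation_minus_iff)

lemma rep_rel: "rep rel_x = 0" "rep rel_y = 0"
  by (simp_all add: rel_x_def rel_y_def rep_simps power2_eq_square U_def V_def sc_def inc_def
      m2_defs coeffs algebra_simps)

lemma rep_z: "rep z = sc [:0, 1:]"
  by (simp add: z_def rep_simps U_def V_def sc_def inc_def m2_defs coeffs algebra_simps)

lemma rep_at_z: "rep (at_z p) = sc (map_poly to_ac p)"
proof (induction p)
  case (pCons k p)
  have "pCons (to_ac k) q = [:to_ac k:] + q * [:0, 1:]" for q :: "'k alg_closure poly"
    by simp
  with pCons show ?case
    by (simp add: rep_simps rep_z map_poly_pCons inc_def flip: sc_simps)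
qed (simp add: rep_simps)

lemma rep_nf: "rep (nf (p 0) (p 1) (p 2) (p 3)) = comb U V (\<lambda>j. map_poly to_ac (p j))"
  by (simp add: nf_def comb_def rep_simps rep_at_z mult.assoc)

lemma comb_rep_eq_0:
  assumes "comb U V q = 0"
  shows "q 0 = 0 \<and> q 1 = 0 \<and> q 2 = 0 \<and> q 3 = 0"
  using assms unfolding U_def V_def by (rule comb_eq_0) auto

lemma rep_ideal: "f \<in> I \<Longrightarrow> rep f = 0"
proof -
  have "ideal {f. rep f = 0} free_alg"
  proof (rule idealI)
    show "subgroup {f. rep f = 0} (add_monoid free_alg)"
    proof
      fix f :: "gens list \<Rightarrow>\<^sub>0 'k" assume f: "f \<in> {f. rep f = 0}"
      have "\<ominus>\<^bsub>free_alg\<^esub> f = - f"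
        by (rule I.minus_equality) simp_all
      then show "inv\<^bsub>add_monoid free_alg\<^esub> f \<in> {f. rep f = 0}"
        using f rep_simps(8)[of 0 f] by (simp add: a_inv_def rep_simps)
    qed (simp_all add: rep_simps)
  qed (simp_all add: ring_free_alg rep_simps)
  then have "I \<subseteq> {f. rep f = 0}"
    unfolding I_def by (rule ring.genideal_minimal[OF ring_free_alg]) (simp add: rep_rel)
  then show "f \<in> I \<Longrightarrow> rep f = 0" by auto
qed

lemma in_I_iff: "f \<in> I \<longleftrightarrow> rep f = 0"
proof
  assume f: "rep f = 0"
  obtain p0 p1 p2 p3 where nf: "f - nf p0 p1 p2 p3 \<in> I" using normal_form_exists by blast
  define p where "p = (\<lambda>j::nat. if j = 0 then p0 else if j = 1 then p1 else if j = 2 then p2 else p3)"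
  have p: "p 0 = p0" "p 1 = p1" "p 2 = p2" "p 3 = p3" by (simp_all add: p_def)
  have "rep (nf p0 p1 p2 p3) = 0" using rep_ideal[OF nf] f by (simp add: rep_simps)
  then have "comb U V (\<lambda>j. map_poly to_ac (p j)) = 0" by (simp only: p flip: rep_nf)
  from comb_rep_eq_0[OF this] have "p0 = 0" "p1 = 0" "p2 = 0" "p3 = 0"
    by (simp_all add: p p(2)[unfolded One_nat_def] map_poly_eq_0_iff)
  with nf show "f \<in> I" by (simp add: nf_def)
qed (rule rep_ideal)

lemma quad_alg_eq: "quad_alg a b c d = quot_alg free_alg I"
  by (simp add: quad_alg_def I_def rel_x_def rel_y_def)

lemma quad_alg_embedded:
  obtains \<phi> where "alg_embedding (quad_alg a b c d) (mat_alg 2 inc) \<phi>"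
    "\<phi> ` carrier (quad_alg a b c d) = to_mat ` range rep"
  using quot_alg_embedding[OF free_ideal_axioms central_hom_inc, of "case_gens U V"] in_I_iff
  unfolding quad_alg_eq rep_def by blast

lemma T_ideal_quad:
  "T_ideal (quad_alg a b c d) =
     {f. \<forall>s. (\<forall>i. s i \<in> range rep) \<longrightarrow> ev (\<lambda>k. sc (inc k)) s f = 0}"
proof -
  obtain \<phi> where \<phi>: "alg_embedding (quad_alg a b c d) (mat_alg 2 inc) \<phi>"
    and img: "\<phi> ` carrier (quad_alg a b c d) = to_mat ` range rep"
    by (rule quad_alg_embedded)
  have "ring (mat_alg 2 inc)" unfolding mat_alg_def by (rule ring_mat)
  moreover have "ring (quad_alg a b c d)" unfolding quad_alg_eq by (rule ring_quot_alg)
  moreover have "k \<odot>\<^bsub>quad_alg a b c d\<^esub> u \<in> carrier (quad_alg a b c d)"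
    if "u \<in> carrier (quad_alg a b c d)" for k u
    using that by (auto simp: quad_alg_eq quot_alg_simps)
  ultimately have T: "T_ideal (quad_alg a b c d) =
      {f. \<forall>S. (\<forall>i. S i \<in> to_mat ` range rep) \<longrightarrow> alg_eval (mat_alg 2 inc) S f = \<zero>\<^bsub>mat_alg 2 inc\<^esub>}"
    using T_ideal_embedded[OF _ _ _ \<phi>] unfolding img by blast
  have zero: "\<zero>\<^bsub>mat_alg 2 inc\<^esub> = to_mat 0"
    by (simp add: mat_alg_def ring_mat_simps to_mat_0)
  have "(\<forall>S. (\<forall>i. S i \<in> to_mat ` range rep) \<longrightarrow> alg_eval (mat_alg 2 inc) S f = to_mat 0) \<longleftrightarrow>
      (\<forall>s. (\<forall>i. s i \<in> range rep) \<longrightarrow> ev (\<lambda>k. sc (inc k)) s f = 0)" (is "?L \<longleftrightarrow> ?R")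
    for f :: "nat list \<Rightarrow>\<^sub>0 'k"
  proof
    assume L: ?L
    show ?R
    proof (intro allI impI)
      fix s :: "nat \<Rightarrow> 'k alg_closure poly m2" assume "\<forall>i. s i \<in> range rep"
      then have "alg_eval (mat_alg 2 inc) (\<lambda>i. to_mat (s i)) f = to_mat 0"
        using L[rule_format, of "\<lambda>i. to_mat (s i)"] by auto
      then show "ev (\<lambda>k. sc (inc k)) s f = 0"
        by (simp add: alg_eval_mat inj_eq[OF inj_to_mat])
    qed
  next
    assume R: ?R
    show ?L
    proof (intro allI impI)
      fix S :: "nat \<Rightarrow> 'k alg_closure poly mat" assume "\<forall>i. S i \<in> to_mat ` range rep"
      then have "\<forall>i. \<exists>A. A \<in> range rep \<and> S i = to_mat A" by auto
      from choice[OF this] obtain s where "\<forall>i. s i \<in> range rep \<and> S i = to_mat (s i)" ..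
      moreover from this have "S = (\<lambda>i. to_mat (s i))" by auto
      ultimately show "alg_eval (mat_alg 2 inc) S f = to_mat 0"
        using R by (simp add: alg_eval_mat)
    qed
  qed
  then show ?thesis by (simp only: T zero)
qed

lemma specialize_inc: "specialize l (sc (inc k)) = sc (to_ac k)"
  by (simp add: specialize_def sc_def inc_def)

lemma T_ideal_mat_subset: "T_ideal (mat_alg 2 to_ac) \<subseteq> T_ideal (quad_alg a b c d)"
proof
  fix f :: "nat list \<Rightarrow>\<^sub>0 'k" assume "f \<in> T_ideal (mat_alg 2 to_ac)"
  then have f: "ev (\<lambda>k. sc (to_ac k)) s f = 0" for s by (simp add: T_ideal_mat)
  have "ev (\<lambda>k. sc (inc k)) s f = 0" for s
    by (rule specialize_eq_0[OF alg_closed_infinite]) (simp add: specialize_ev specialize_inc f)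
  then show "f \<in> T_ideal (quad_alg a b c d)" by (simp add: T_ideal_quad)
qed

lemma T_ideal_quad_subset: "T_ideal (quad_alg a b c d) \<subseteq> T_ideal (mat_alg 2 to_ac)"
proof
  fix f :: "nat list \<Rightarrow>\<^sub>0 'k" assume f: "f \<in> T_ideal (quad_alg a b c d)"
  define P where "P = range (map_poly (to_ac :: 'k \<Rightarrow> 'k alg_closure))"
  have "inj (\<lambda>n. map_poly (to_ac :: 'k \<Rightarrow> 'k alg_closure) (monom 1 n))"
    by (rule injI) (simp add: map_poly_monom monom_eq_iff')
  from finite_imageD[OF _ this] have "infinite (range (\<lambda>n. map_poly (to_ac :: 'k \<Rightarrow> 'k alg_closure) (monom 1 n)))"
    by blast
  moreover have "range (\<lambda>n. map_poly (to_ac :: 'k \<Rightarrow> 'k alg_closure) (monom 1 n)) \<subseteq> P"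
    by (auto simp: P_def)
  ultimately have P: "infinite P" using finite_subset by blast
  have small: "ev (\<lambda>k. sc (inc k)) (\<lambda>i. comb U V (q i)) f = 0" if q: "\<And>i j. q i j \<in> P"
    for q :: "nat \<Rightarrow> nat \<Rightarrow> 'k alg_closure poly"
  proof -
    have "comb U V (q i) \<in> range rep" for i
    proof -
      have "\<forall>j. \<exists>p. q i j = map_poly to_ac p" using q[of i] by (auto simp: P_def)
      from choice[OF this] obtain p where "q i = (\<lambda>j. map_poly to_ac (p j))" by auto
      then show ?thesis by (simp flip: rep_nf)
    qed
    then show ?thesis using f by (simp add: T_ideal_quad)
  qed
  note all = identity_extends[OF P small]
  \<comment> \<open>The two excluded values are those at which \<open>w\<close> or \<open>(r - r')(s - s') + w\<close> vanishes for the
    corner entry \<open>w\<close> of the specialized \<open>V\<close>.\<close>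
  have "infinite (UNIV - {r * s + r' * s', r * s' + r' * s} :: 'k alg_closure set)"
    by (simp add: alg_closed_infinite)
  then obtain l where l: "l \<noteq> r * s + r' * s'" "l \<noteq> r * s' + r' * s"
    using infinite_imp_nonempty by blast
  define w where "w = l - (r * s + r' * s')"
  have w: "w \<noteq> 0" "(r - r') * (s - s') + w \<noteq> 0"
    using l by (simp_all add: w_def algebra_simps)
  have UV: "specialize l U = M2 r 1 0 r'" "specialize l V = M2 s 0 w s'"
    by (simp_all add: specialize_def U_def V_def w_def)
  have "ev (\<lambda>k. sc (to_ac k)) A f = 0" for A
  proof -
    have "\<forall>i. \<exists>q. A i = comb (M2 r 1 0 r') (M2 s 0 w s') q"
      using comb_surj[OF w] by metis
    from choice[OF this] obtain q where q: "A i = comb (M2 r 1 0 r') (M2 s 0 w s') (q i)" for i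
      by auto
    have "specialize l (ev (\<lambda>k. sc (inc k)) (\<lambda>i. comb U V (\<lambda>j. [:q i j:])) f) =
        ev (\<lambda>k. sc (to_ac k)) A f"
      by (simp add: specialize_ev specialize_inc specialize_comb UV flip: q)
    then show ?thesis by (simp add: all specialize_def m2_defs)
  qed
  then show "f \<in> T_ideal (mat_alg 2 to_ac)" by (simp add: T_ideal_mat)
qed

end

theorem theorem3:
  fixes a b c d :: "'k::field"
  shows "(\<exists>\<phi>. alg_embedding (quad_alg a b c d)
              (mat_alg 2 (\<lambda>k. [:to_ac k:] :: 'k alg_closure poly)) \<phi>) \<and>
         T_ideal (quad_alg a b c d) = T_ideal (mat_alg 2 (to_ac :: 'k \<Rightarrow> 'k alg_closure))"
proof -
  obtain r r' where r: "r + r' = - to_ac a" "r * r' = to_ac b" by (rule quadratic_splits)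
  obtain t t' where t: "t + t' = - to_ac c" "t * t' = to_ac d" by (rule quadratic_splits)
  have roots: "quad_roots a b c d r r' t t'"
    using r t by (rule quad_roots.intro)
  have inc: "inc = (\<lambda>k. [:to_ac k:] :: 'k alg_closure poly)"
    by (intro ext) (rule inc_def)
  obtain \<phi> where "alg_embedding (quad_alg a b c d) (mat_alg 2 inc) \<phi>"
    by (rule quad_roots.quad_alg_embedded[OF roots])
  moreover have "T_ideal (quad_alg a b c d) = T_ideal (mat_alg 2 (to_ac :: 'k \<Rightarrow> 'k alg_closure))"
    by (rule equalityI[OF quad_roots.T_ideal_quad_subset[OF roots]
          quad_roots.T_ideal_mat_subset[OF roots]])
  ultimately show ?thesis unfolding inc by blast
qed

end
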